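(* The toroidal core graph $M$ has the Walsh index series $$W_M(\mathbf a;\mathbf b;\mathbf c)=\tfrac{1}{144}\big[a_1^8b_1^{19}+a_1^6a_2b_1^6b_2^6c_1+6(a_1^6a_2b_1^{12}b_2^3c_1+a_1^4a_2^2b_1^3b_2^7c_1^2)+9(a_1^4a_2^2b_1^5b_2^6c_1^2+a_1^2a_2^3b_2^8c_1^3)$$ $$+6(a_1^2a_2^3b_1b_2^9+a_2^4b_2^9c_1)+4(a_1^5a_3b_1^{10}b_3^3+a_1^3a_2a_3b_1^3b_2^3b_3b_6c_1)+12(a_1^3a_2a_3b_1^3b_2^3b_3^3c_1+a_1a_2^2a_3b_2^4b_3b_6c_1^2)$$ $$+4(a_1^2a_3^2b_1b_3^6+a_2a_3^2b_3^2b_6^2c_1)+18(a_1^2a_2a_4b_1b_2^2b_4^3c_2+a_2^2a_4b_2^2b_4^3c_1c_2)+12(a_1^2a_6b_1b_6^3+a_2a_6b_6^3c_1)\big],$$ and the toroidal core graph $M^*$ has the Walsh index series $$W_{M^*}(\mathbf a;\mathbf b;\mathbf c)=\tfrac{1}{144}\big[a_1^8b_1^{18}+a_1^6a_2b_1^6b_2^6+6(a_1^6a_2b_1^{11}b_2^3c_1+a_1^4a_2^2b_1^3b_2^7c_1)+9(a_1^4a_2^2b_1^4b_2^6c_1^2+a_1^2a_2^3b_2^8c_1^2)$$ $$+6(a_1^2a_2^3b_2^9+a_2^4b_2^9)+4(a_1^5a_3b_1^9b_3^3+a_1^3a_2a_3b_1^3b_2^3b_3b_6)+12(a_1^3a_2a_3b_1^2b_2^3b_3^3c_1+a_1a_2^2a_3b_2^4b_3b_6c_1)$$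 $$+4(a_1^2a_3^2b_3^6+a_2a_3^2b_3^2b_6^2)+18(a_1^2a_2a_4b_2^2b_4^3c_2+a_2^2a_4b_2^2b_4^3c_2)+12(a_1^2a_6b_6^3+a_2a_6b_6^3)\big].$$
   Context: $M$ is the graph obtained from two disjoint copies of $K_5$ by identifying an edge of one with an edge of the other (so $M$ has 8 vertices and 19 edges); $M^*$ is obtained from $M$ by deleting the edge of identification. For a finite simple graph $G$ and $\sigma\in\mathrm{Aut}(G)$, $\sigma$ induces a permutation of $E(G)$; a cycle of length $l$ of this permutation is cylindrical if $\sigma^l$ fixes both endpoints of each edge of the cycle, and Möbius if $\sigma^l$ exchanges the two endpoints of each edge of the cycle. Let $\sigma_k$ be the number of vertex cycles of $\sigma$ of length $k$, and $\mathrm{cyl}_k(G,\sigma)$, $\mathrm{m\ddot ob}_k(G,\sigma)$ the numbers of cylindrical and Möbius edge cycles of length $k$. Put $w(G,\sigma)=\prod_{k\ge1}a_k^{\sigma_k}b_k^{\mathrm{cyl}_k(G,\sigma)}c_k^{\mathrm{m\ddot ob}_k(G,\sigma)}$. The Walsh index series of (the isomorphism class of) a single graph $G$ is $$W_G(\mathbf a;\mathbf b;\mathbf c)=\frac{1}{|\mathrm{Aut}(G)|}\sum_{\sigma\in\mathrm{Aut}(G)}w(G,\sigma).$$ *)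

theory Defs
  imports Complex_Main "HOL-Library.Poly_Mapping" "HOL-Combinatorics.Permutations" "HOL-Combinatorics.Orbits"
begin

subsection \<open>Finite simple graphs\<close>

text \<open>Edges are two-element sets of vertices, so parallel edges arising from an
  identification of vertices are merged automatically.\<close>

datatype 'a graph = Graph (verts: "'a set") (edges: "'a set set")

definition finite_simple_graph :: "'a graph \<Rightarrow> bool" where
  "finite_simple_graph G \<longleftrightarrow>
     finite (verts G) \<and> (\<forall>e\<in>edges G. e \<subseteq> verts G \<and> card e = 2)"

definition complete_graph :: "'a set \<Rightarrow> 'a graph" where
  "complete_graph V = Graph V {e. e \<subseteq> V \<and> card e = 2}"

definition graph_union :: "'a graph \<Rightarrow> 'a graph \<Rightarrow> 'a graph" where
  "graph_union G H = Graph (verts G \<union> verts H) (edges G \<union> edges H)"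

definition delete_edge :: "'a graph \<Rightarrow> 'a set \<Rightarrow> 'a graph" where
  "delete_edge G e = Graph (verts G) (edges G - {e})"

definition identify_edges :: "'a graph \<Rightarrow> 'a \<times> 'a \<Rightarrow> 'a \<times> 'a \<Rightarrow> 'a graph" where
  "identify_edges G = (\<lambda>(p1, p2) (q1, q2).
     let h = id(q1 := p1, q2 := p2) in Graph (h ` verts G) ((`) h ` edges G))"

text \<open>An automorphism is represented by a permutation of the whole type that is the
  identity outside the vertex set, so that automorphisms are not counted repeatedly.\<close>

definition Aut :: "'a graph \<Rightarrow> ('a \<Rightarrow> 'a) set" where
  "Aut G = {\<sigma>. \<sigma> permutes verts G \<and>
     (\<forall>u\<in>verts G. \<forall>v\<in>verts G. {u, v} \<in> edges G \<longleftrightarrow> {\<sigma> u, \<sigma> v} \<in> edges G)}"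


subsection \<open>Vertex and edge cycles\<close>

definition cycles :: "('b \<Rightarrow> 'b) \<Rightarrow> 'b set \<Rightarrow> 'b set set" where
  "cycles f S = orbit f ` S"

definition vertex_cycles :: "'a graph \<Rightarrow> ('a \<Rightarrow> 'a) \<Rightarrow> 'a set set" where
  "vertex_cycles G \<sigma> = cycles \<sigma> (verts G)"

definition edge_cycles :: "'a graph \<Rightarrow> ('a \<Rightarrow> 'a) \<Rightarrow> 'a set set set" where
  "edge_cycles G \<sigma> = cycles ((`) \<sigma>) (edges G)"

definition cylindrical :: "('a \<Rightarrow> 'a) \<Rightarrow> 'a set set \<Rightarrow> bool" where
  "cylindrical \<sigma> c \<longleftrightarrow> (\<forall>e\<in>c. \<forall>v\<in>e. (\<sigma> ^^ card c) v = v)"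

definition moebius :: "('a \<Rightarrow> 'a) \<Rightarrow> 'a set set \<Rightarrow> bool" where
  "moebius \<sigma> c \<longleftrightarrow> (\<forall>e\<in>c. \<exists>u v. u \<noteq> v \<and> e = {u, v} \<and>
     (\<sigma> ^^ card c) u = v \<and> (\<sigma> ^^ card c) v = u)"

definition cyc_count :: "'a graph \<Rightarrow> ('a \<Rightarrow> 'a) \<Rightarrow> nat \<Rightarrow> nat" where
  "cyc_count G \<sigma> k = card {c \<in> vertex_cycles G \<sigma>. card c = k}"

definition cyl_count :: "'a graph \<Rightarrow> ('a \<Rightarrow> 'a) \<Rightarrow> nat \<Rightarrow> nat" where
  "cyl_count G \<sigma> k = card {c \<in> edge_cycles G \<sigma>. card c = k \<and> cylindrical \<sigma> c}"

definition moeb_count :: "'a graph \<Rightarrow> ('a \<Rightarrow> 'a) \<Rightarrow> nat \<Rightarrow> nat" where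
  "moeb_count G \<sigma> k = card {c \<in> edge_cycles G \<sigma>. card c = k \<and> moebius \<sigma> c}"


subsection \<open>The Walsh index series\<close>

text \<open>The series of a single finite graph is a polynomial with rational coefficients in the
  indeterminates $a_k$, $b_k$, $c_k$. Polynomials are finitely supported maps from monomials
  to coefficients, and monomials are finitely supported maps from indeterminates to
  exponents; the product on \<open>\<Rightarrow>\<^sub>0\<close> is convolution.\<close>

datatype walsh_var = Var_a nat | Var_b nat | Var_c nat

type_synonym walsh_poly = "(walsh_var \<Rightarrow>\<^sub>0 nat) \<Rightarrow>\<^sub>0 rat"

definition indet :: "walsh_var \<Rightarrow> walsh_poly" where
  "indet x = Poly_Mapping.single (Poly_Mapping.single x 1) 1"

definition const :: "rat \<Rightarrow> walsh_poly" where
  "const r = Poly_Mapping.single 0 r"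

definition \<a> :: "nat \<Rightarrow> walsh_poly" where "\<a> k = indet (Var_a k)"
definition \<b> :: "nat \<Rightarrow> walsh_poly" where "\<b> k = indet (Var_b k)"
definition \<c> :: "nat \<Rightarrow> walsh_poly" where "\<c> k = indet (Var_c k)"

text \<open>The product ranges over all \<open>k\<close> and has only finitely many factors different from
  \<open>1\<close> when \<open>G\<close> is finite. The factor at \<open>k = 0\<close> is then \<open>1\<close>, as cycles are finite and nonempty.\<close>

definition cycle_weight :: "'a graph \<Rightarrow> ('a \<Rightarrow> 'a) \<Rightarrow> walsh_poly" where
  "cycle_weight G \<sigma> =
     (\<Prod>k. \<a> k ^ cyc_count G \<sigma> k * \<b> k ^ cyl_count G \<sigma> k * \<c> k ^ moeb_count G \<sigma> k)"

definition walsh_index :: "'a graph \<Rightarrow> walsh_poly" where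
  "walsh_index G = const (1 / of_nat (card (Aut G))) * (\<Sum>\<sigma>\<in>Aut G. cycle_weight G \<sigma>)"


subsection \<open>The toroidal cores\<close>

definition core_M :: "'a set \<Rightarrow> 'a \<times> 'a \<Rightarrow> 'a set \<Rightarrow> 'a \<times> 'a \<Rightarrow> 'a graph" where
  "core_M P p Q q = identify_edges (graph_union (complete_graph P) (complete_graph Q)) p q"

definition core_M_star :: "'a set \<Rightarrow> 'a \<times> 'a \<Rightarrow> 'a set \<Rightarrow> 'a \<times> 'a \<Rightarrow> 'a graph" where
  "core_M_star P p Q q = delete_edge (core_M P p Q q) {fst p, snd p}"

text \<open>\<open>(P, (p1, p2))\<close> and \<open>(Q, (q1, q2))\<close> are two disjoint five-element vertex sets, each with
  the end points of an edge of the complete graph on it.\<close>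

definition disjoint_K5s :: "'a set \<Rightarrow> 'a \<times> 'a \<Rightarrow> 'a set \<Rightarrow> 'a \<times> 'a \<Rightarrow> bool" where
  "disjoint_K5s P p Q q \<longleftrightarrow> card P = 5 \<and> card Q = 5 \<and> P \<inter> Q = {} \<and>
     {fst p, snd p} \<in> edges (complete_graph P) \<and> {fst q, snd q} \<in> edges (complete_graph Q)"

lemma core_M_altdef:
  assumes "disjoint_K5s P (p1, p2) Q (q1, q2)"
  shows "core_M P (p1, p2) Q (q1, q2) =
    graph_union (complete_graph P) (complete_graph (Q - {q1, q2} \<union> {p1, p2}))"
proof -
  define h where "h = id(q1 := p1, q2 := p2)"
  define R where "R = Q - {q1, q2} \<union> {p1, p2}"
  from assms have disj: "P \<inter> Q = {}" and p: "p1 \<in> P" "p2 \<in> P" "p1 \<noteq> p2"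
    and q: "q1 \<in> Q" "q2 \<in> Q" "q1 \<noteq> q2"
    unfolding disjoint_K5s_def complete_graph_def by (auto simp: card_2_iff doubleton_eq_iff)
  have hP: "h x = x" if "x \<in> P" for x
    using that disj q unfolding h_def by auto
  have imP: "h ` e = e" if "e \<subseteq> P" for e
    using hP that by force
  have hQ: "h ` Q = R"
    using q unfolding h_def R_def by (auto simp: image_iff)
  have inj: "inj_on h Q"
    using q p disj unfolding h_def inj_on_def by auto
  have EP: "(`) h ` {e. e \<subseteq> P \<and> card e = 2} = {e. e \<subseteq> P \<and> card e = 2}"
    using imP by force
  have EQ: "(`) h ` {e. e \<subseteq> Q \<and> card e = 2} = {e. e \<subseteq> R \<and> card e = 2}"
  proof (intro equalityI subsetI)
    fix e assume "e \<in> (`) h ` {e. e \<subseteq> Q \<and> card e = 2}"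
    then obtain d where d: "d \<subseteq> Q" "card d = 2" "e = h ` d" by auto
    then have "card e = 2" using card_image[OF inj_on_subset[OF inj d(1)]] by simp
    then show "e \<in> {e. e \<subseteq> R \<and> card e = 2}" using d hQ by auto
  next
    fix e assume e: "e \<in> {e. e \<subseteq> R \<and> card e = 2}"
    then have "e \<subseteq> h ` Q" unfolding hQ by simp
    then obtain d where d: "d \<subseteq> Q" "e = h ` d" unfolding subset_image_iff by blast
    then have "card d = 2" using e card_image[OF inj_on_subset[OF inj d(1)]] by simp
    then show "e \<in> (`) h ` {e. e \<subseteq> Q \<and> card e = 2}" using d by auto
  qed
  have VP: "h ` P = P" using imP by blast
  show ?thesis
    unfolding core_M_def identify_edges_def graph_union_def complete_graph_def Let_def
      prod.case graph.sel h_def[symmetric] R_def[symmetric] image_Un EP EQ VP hQ ..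
qed

lemma core_M_counts:
  assumes "disjoint_K5s P p Q q"
  shows "finite_simple_graph (core_M P p Q q)"
    and "card (verts (core_M P p Q q)) = 8"
    and "card (edges (core_M P p Q q)) = 19"
    and "card (edges (core_M_star P p Q q)) = 18"
proof -
  obtain p1 p2 q1 q2 where pq: "p = (p1, p2)" "q = (q1, q2)" by (cases p, cases q) auto
  define R where "R = Q - {q1, q2} \<union> {p1, p2}"
  define E where "E = (\<lambda>V :: 'a set. {e. e \<subseteq> V \<and> card e = 2})"
  note M = core_M_altdef[OF assms[unfolded pq], folded pq R_def]
  from assms have c: "card P = 5" "card Q = 5" and disj: "P \<inter> Q = {}"
    and p: "p1 \<in> P" "p2 \<in> P" "p1 \<noteq> p2" and q: "q1 \<in> Q" "q2 \<in> Q" "q1 \<noteq> q2"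
    unfolding disjoint_K5s_def complete_graph_def pq by (auto simp: card_2_iff doubleton_eq_iff)
  have fin: "finite P" "finite Q" using c by (auto intro: card_ge_0_finite)
  have cR': "card (Q - {q1, q2}) = 3" using c q fin by (simp add: card_Diff_subset)
  have "(Q - {q1, q2}) \<inter> {p1, p2} = {}" using disj p by auto
  then have cR: "card R = 5" unfolding R_def using cR' p fin by (subst card_Un_disjoint) auto
  have finR: "finite R" unfolding R_def using fin by auto
  have PR: "P \<inter> R = {p1, p2}" unfolding R_def using disj p by auto
  have V: "verts (core_M P p Q q) = P \<union> R" and Ed: "edges (core_M P p Q q) = E P \<union> E R"
    unfolding M graph_union_def complete_graph_def E_def by simp_all
  show "finite_simple_graph (core_M P p Q q)"
    unfolding finite_simple_graph_def V Ed using fin finR by (auto simp: E_def)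
  have "card (P \<union> R) + card (P \<inter> R) = 10" using card_Un_Int[OF fin(1) finR] c cR by simp
  then show "card (verts (core_M P p Q q)) = 8" unfolding V PR using p by simp
  have finE: "finite (E P)" "finite (E R)" unfolding E_def using fin finR by simp_all
  have ch: "(5 :: nat) choose 2 = 10" by (simp add: numeral_eq_Suc)
  have cE: "card (E P) = 10" "card (E R) = 10"
    unfolding E_def using n_subsets[OF fin(1), of 2] n_subsets[OF finR, of 2] c cR ch by simp_all
  have "E P \<inter> E R = {{p1, p2}}"
  proof -
    have "E P \<inter> E R = {e. e \<subseteq> {p1, p2} \<and> card e = 2}" unfolding E_def using PR by auto
    also have "\<dots> = {{p1, p2}}" using p by (auto simp: card_2_iff doubleton_eq_iff)
    finally show ?thesis .
  qed
  then have "card (E P \<union> E R) + 1 = 20" using card_Un_Int[OF finE] cE by simp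
  then show n: "card (edges (core_M P p Q q)) = 19" unfolding Ed by simp
  have "{p1, p2} \<in> edges (core_M P p Q q)" unfolding Ed E_def using p by auto
  then show "card (edges (core_M_star P p Q q)) = 18"
    unfolding core_M_star_def delete_edge_def using n by (simp add: pq card_Diff_singleton)
qed

end

theory Submission
  imports Defs
begin

text \<open>Label the vertices by \<open>0, \<dots>, 7\<close>. The automorphisms are then the permutations of the labels
  that preserve adjacency, and they can be enumerated by extending partial embeddings one vertex
  at a time. A cycle of length \<open>k\<close> consists of \<open>k\<close> vertices or edges that first return after \<open>k\<close>
  steps, so the number of cycles of each kind is the number of vertices or edges whose first
  return has that kind, divided by \<open>k\<close>; an edge \<open>{u, v}\<close> lies on a cylindrical or a Moebius cycle
  according to whether \<open>u\<close> is fixed at its first return. Both series thus come down to evaluating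
  the weights of 144 permutations.\<close>

subsection \<open>Orbits and cycles\<close>

text \<open>Minimality of \<open>l\<close> makes the iterates below \<open>l\<close> pairwise
  distinct, and the return at \<open>l\<close> makes them exhaust the orbit.\<close>

lemma card_orbit_eqI:
  assumes "0 < l" and "(f ^^ l) x = x" and least: "\<And>j. 0 < j \<Longrightarrow> j < l \<Longrightarrow> (f ^^ j) x \<noteq> x"
  shows "card (orbit f x) = l"
proof -
  have "inj_on (\<lambda>m. (f ^^ m) x) {..<l}"
  proof (rule linorder_inj_onI)
    fix i j assume ij: "i < j" "i \<in> {..<l}" "j \<in> {..<l}"
    show "(f ^^ i) x \<noteq> (f ^^ j) x"
    proof
      assume "(f ^^ i) x = (f ^^ j) x"
      \<comment> \<open>Apply \<open>f ^^ (l - j)\<close> to both sides: the right becomes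
        \<open>(f ^^ l) x = x\<close>, so \<open>x\<close> would already return at the positive step
        \<open>l - j + i < l\<close>.\<close>
      then have "(f ^^ (l - j + i)) x = (f ^^ (l - j + j)) x"
        by (simp only: funpow_add comp_apply)
      then show False using ij assms(2) least[of "l - j + i"] by simp
    qed
  qed auto
  moreover have "orbit f x = (\<lambda>m. (f ^^ m) x) ` {..<l}"
    using orbit_altdef_bounded[OF assms(2,1)] by auto
  ultimately show ?thesis by (simp add: card_image)
qed

text \<open>\<open>orbit f x\<close> is generated from \<open>f x\<close>, so the assumption says
  that \<open>x\<close> is periodic; the iterates up to the first return
  \<open>funpow_dist1 f x x\<close> then run through the orbit once.\<close>

lemma funpow_card_orbit:
  assumes "x \<in> orbit f x"
  shows "0 < card (orbit f x)" and "(f ^^ card (orbit f x)) x = x"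
proof -
  have "card (orbit f x) = funpow_dist1 f x x"
    using inj_on_funpow_dist1[OF assms] orbit_conv_funpow_dist1[OF assms]
    by (metis card_atLeastLessThan card_image diff_zero)
  then show "0 < card (orbit f x)" and "(f ^^ card (orbit f x)) x = x"
    using funpow_dist1_prop[OF assms] by simp_all
qed

lemma orbit_subset_invariant:
  assumes "x \<in> S" and "\<And>y. y \<in> S \<Longrightarrow> f y \<in> S"
  shows "orbit f x \<subseteq> S"
proof
  fix y assume "y \<in> orbit f x"
  then show "y \<in> S" by induction (use assms in auto)
qed

text \<open>The iterates stay in a finite set, so two of them agree; injectivity cancels the common
  initial steps, and \<open>x\<close> itself recurs.\<close>

lemma self_in_orbit_finite:
  assumes "inj f" and "finite S" and "x \<in> S" and "\<And>y. y \<in> S \<Longrightarrow> f y \<in> S"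
  shows "x \<in> orbit f x"
proof -
  have "(f ^^ n) x \<in> S" for n using assms(3,4) by (induction n) auto
  then have "finite {y. \<exists>n. y = (f ^^ n) x}"
    by (intro finite_subset[OF _ assms(2)]) auto
  then obtain n where "n > 0" "(f ^^ n) x = x"
    using funpow_inj_finite[OF assms(1)] by blast
  then show ?thesis by (auto simp: orbit_altdef intro!: exI[of _ n])
qed

text \<open>Double counting: the cycles of length \<open>k\<close> with property \<open>R\<close>
  partition the elements lying on them into blocks of size \<open>k\<close>. The parameter
  \<open>R\<close> will be trivial, \<open>cylindrical\<close> or \<open>moebius\<close>.\<close>

lemma card_cycles_of_length:
  assumes "inj f" and "finite S" and "\<And>y. y \<in> S \<Longrightarrow> f y \<in> S"
  shows "card {c \<in> cycles f S. card c = k \<and> R c} =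
    card {x \<in> S. card (orbit f x) = k \<and> R (orbit f x)} div k"
proof -
  let ?C = "{c \<in> cycles f S. card c = k \<and> R c}"
  have self: "x \<in> orbit f x" if "x \<in> S" for x
    using self_in_orbit_finite[OF assms(1,2) that assms(3)] .
  have sub: "orbit f x \<subseteq> S" if "x \<in> S" for x
    using orbit_subset_invariant[OF that assms(3)] .
  \<comment> \<open>Being in the same orbit is symmetric for recurrent points, so orbits that meet
    coincide.\<close>
  have eq: "orbit f y = orbit f x" if "x \<in> S" "y \<in> orbit f x" for x y
  proof
    show "orbit f y \<subseteq> orbit f x" using orbit_trans[OF _ that(2)] by blast
    show "orbit f x \<subseteq> orbit f y"
      using orbit_trans[OF _ orbit_swap[OF self[OF that(1)] that(2)]] by blast
  qed
  have un: "\<Union>?C = {x \<in> S. card (orbit f x) = k \<and> R (orbit f x)}"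
  proof (intro equalityI subsetI)
    fix y assume "y \<in> \<Union>?C"
    then obtain x where x: "x \<in> S" "y \<in> orbit f x" "card (orbit f x) = k" "R (orbit f x)"
      unfolding cycles_def by auto
    then show "y \<in> {x \<in> S. card (orbit f x) = k \<and> R (orbit f x)}"
      using sub[OF x(1)] eq[OF x(1,2)] by auto
  next
    fix y assume "y \<in> {x \<in> S. card (orbit f x) = k \<and> R (orbit f x)}"
    then show "y \<in> \<Union>?C" using self[of y] unfolding cycles_def by auto
  qed
  have fin: "finite ?C" unfolding cycles_def using assms(2) by simp
  have mult: "k * card ?C = card (\<Union>?C)"
  proof (rule card_partition)
    show "finite (\<Union>?C)" unfolding un using assms(2) by simp
    show "c \<inter> d = {}" if "c \<in> ?C" "d \<in> ?C" "c \<noteq> d" for c d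
    proof -
      from that obtain x y where "x \<in> S" "y \<in> S" "c = orbit f x" "d = orbit f y"
        unfolding cycles_def by auto
      with eq that(3) show ?thesis by (metis disjoint_iff)
    qed
  qed (use fin in auto)
  show ?thesis
  proof (cases "k = 0")
    \<comment> \<open>Cycles are nonempty and finite, so none has size 0; the right-hand side is 0
      because division by 0 yields 0.\<close>
    case True
    have "card c > 0" if c: "c \<in> cycles f S" for c
      using c funpow_card_orbit(1)[OF self] unfolding cycles_def by auto
    then have "?C = {}" using True by fastforce
    then show ?thesis using True by (simp only: card.empty div_by_0)
  next
    case False
    then show ?thesis unfolding un[symmetric] mult[symmetric] by simp
  qed
qed

lemma funpow_image:
  fixes f :: "'a \<Rightarrow> 'a"
  shows "((`) f ^^ k) A = (f ^^ k) ` A"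
  by (induction k) (simp_all add: image_comp)

text \<open>The argument \<open>m\<close> bounds the search; the value is junk if there is no return within \<open>m\<close> steps.\<close>

fun return_time :: "('a \<Rightarrow> bool) \<Rightarrow> ('a \<Rightarrow> 'a) \<Rightarrow> nat \<Rightarrow> 'a \<Rightarrow> nat" where
  "return_time P f 0 x = 0"
| "return_time P f (Suc m) x = (if P (f x) then 1 else Suc (return_time P f m (f x)))"

text \<open>A hit at some step \<open>j\<close> with \<open>0 < j\<close> and
  \<open>j \<le> m\<close> keeps the search from exhausting its bound, so the junk value is never
  reached.\<close>

lemma return_time:
  assumes "P ((f ^^ j) x)" and "0 < j" and "j \<le> m"
  shows "0 < return_time P f m x" and "P ((f ^^ return_time P f m x) x)"
    and "0 < i \<Longrightarrow> i < return_time P f m x \<Longrightarrow> \<not> P ((f ^^ i) x)"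
proof -
  have "0 < return_time P f m x \<and> P ((f ^^ return_time P f m x) x) \<and>
    (\<forall>i. 0 < i \<longrightarrow> i < return_time P f m x \<longrightarrow> \<not> P ((f ^^ i) x))"
    using assms
  proof (induction m arbitrary: x j)
    case (Suc m)
    show ?case
    proof (cases "P (f x)")
      case False
      \<comment> \<open>As \<open>f x\<close> is no hit, the given hit comes later; seen from
        \<open>f x\<close> it is one step closer and still positive.\<close>
      obtain j' where j: "j = Suc j'" using Suc.prems by (cases j) auto
      have "0 < j'" using False Suc.prems j by (cases j') auto
      then have IH: "0 < return_time P f m (f x)" "P ((f ^^ return_time P f m (f x)) (f x))"
        "\<And>i. 0 < i \<Longrightarrow> i < return_time P f m (f x) \<Longrightarrow> \<not> P ((f ^^ i) (f x))"
        using Suc.IH[of j' "f x"] Suc.prems j by (auto simp: funpow_swap1)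
      have "\<not> P ((f ^^ i) x)" if "0 < i" "i < Suc (return_time P f m (f x))" for i
      proof (cases i)
        case (Suc i')
        then show ?thesis using IH(3)[of i'] that False
          by (cases "i' = 0") (auto simp: funpow_swap1)
      qed (use that in simp)
      then show ?thesis using IH False by (auto simp: funpow_swap1)
    qed auto
  qed simp
  then show "0 < return_time P f m x" and "P ((f ^^ return_time P f m x) x)"
    and "0 < i \<Longrightarrow> i < return_time P f m x \<Longrightarrow> \<not> P ((f ^^ i) x)" by auto
qed


subsection \<open>Tallies\<close>

text \<open>A list rather than a multiset, so that evaluation ends in a literal table.
  \<open>remdups\<close> keeps last occurrences, which fixes the order of the entries.\<close>

definition tally :: "'a list \<Rightarrow> ('a \<times> nat) list" where
  "tally xs = map (\<lambda>x. (x, count_list xs x)) (remdups xs)"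

text \<open>Equal terms are collected. The semiring is arbitrary because the lemma serves sums of
  polynomials as well as the total number of entries.\<close>

lemma sum_list_tally:
  fixes f :: "'a \<Rightarrow> 'b::comm_semiring_1"
  shows "sum_list (map f xs) = (\<Sum>(x, k)\<leftarrow>tally xs. of_nat k * f x)"
proof -
  have "sum_list (map f xs) = (\<Sum>x\<in>set xs. of_nat (count_list xs x) * f x)"
  proof (induction xs)
    case (Cons y xs)
    \<comment> \<open>If \<open>y\<close> is new, its multiplicity in \<open>xs\<close> is 0 and its
      term vanishes.\<close>
    have *: "(\<Sum>x\<in>insert y (set xs). of_nat (count_list xs x) * f x) =
      (\<Sum>x\<in>set xs. of_nat (count_list xs x) * f x)"
      by (rule sum.mono_neutral_right) (auto simp: count_list_0_iff)
    have "(\<Sum>x\<in>set (y # xs). of_nat (count_list (y # xs) x) * f x) =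
      (\<Sum>x\<in>insert y (set xs). (if x = y then f x else 0) + of_nat (count_list xs x) * f x)"
      by (intro sum.cong) (auto simp: algebra_simps)
    also have "\<dots> = f y + (\<Sum>x\<in>set xs. of_nat (count_list xs x) * f x)"
      by (simp add: sum.distrib *)
    finally show ?case using Cons.IH by simp
  qed simp
  also have "\<dots> = (\<Sum>(x, k)\<leftarrow>tally xs. of_nat k * f x)"
    by (simp add: tally_def comp_def sum.distinct_set_conv_list[symmetric])
  finally show ?thesis .
qed

lemma length_tally: "sum_list (map snd (tally xs)) = length xs"
  using sum_list_tally[of "\<lambda>_. 1 :: nat" xs]
  by (simp add: sum_list_triv case_prod_unfold)

lemma count_list_map_card:
  assumes "distinct xs"
  shows "count_list (map f xs) y = card {x \<in> set xs. f x = y}"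
proof -
  have "{x \<in> set xs. f x = y} = set (filter (\<lambda>x. y = f x) xs)" by auto
  then show ?thesis using assms
    by (simp add: count_list_eq_length_filter filter_map comp_def distinct_card del: set_filter)
qed


subsection \<open>Labelled graphs\<close>

text \<open>The index is the length of the cycles that the variable marks, hence the divisor turning
  a number of elements into a number of cycles.\<close>

fun var_index :: "walsh_var \<Rightarrow> nat" where
  "var_index (Var_a k) = k"
| "var_index (Var_b k) = k"
| "var_index (Var_c k) = k"

definition vertex_var :: "nat \<Rightarrow> (nat \<Rightarrow> nat) \<Rightarrow> nat \<Rightarrow> walsh_var" where
  "vertex_var m f v = Var_a (return_time (\<lambda>w. w = v) f m v)"

text \<open>An edge is stored as an ordered pair but returns in either orientation; the orientation
  at the first return separates the two kinds of cycle.\<close>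

definition edge_var :: "nat \<Rightarrow> (nat \<Rightarrow> nat) \<Rightarrow> nat \<times> nat \<Rightarrow> walsh_var" where
  "edge_var m f = (\<lambda>(u, v).
     let l = return_time (\<lambda>e. e = (u, v) \<or> e = (v, u)) (map_prod f f) m (u, v)
     in if (f ^^ l) u = u then Var_b l else Var_c l)"

text \<open>Each element names the variable of its cycle, so a cycle of length \<open>k\<close>
  contributes \<open>k\<close> equal entries. No cycle is longer than the number of vertices or
  edges, whence the search bounds.\<close>

definition cycle_vars :: "nat \<Rightarrow> (nat \<times> nat) list \<Rightarrow> nat list \<Rightarrow> walsh_var list" where
  "cycle_vars n es xs =
     map (vertex_var n ((!) xs)) [0..<n] @ map (edge_var (length es) ((!) xs)) es"

text \<open>The order of the variables is immaterial; it only gives equal monomials equal lists of exponents.\<close>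

fun var_rank :: "walsh_var \<Rightarrow> nat" where
  "var_rank (Var_a k) = 3 * k"
| "var_rank (Var_b k) = 3 * k + 1"
| "var_rank (Var_c k) = 3 * k + 2"

definition cycle_type :: "nat \<Rightarrow> (nat \<times> nat) list \<Rightarrow> nat list \<Rightarrow> (walsh_var \<times> nat) list" where
  "cycle_type n es xs = map (\<lambda>(x, k). (x, k div var_index x))
     (sort_key (\<lambda>p. var_rank (fst p)) (tally (cycle_vars n es xs)))"

definition monomial :: "(walsh_var \<times> nat) list \<Rightarrow> walsh_poly" where
  "monomial t = (\<Prod>(x, k)\<leftarrow>t. indet x ^ k)"

lemma monomial_cycle_type:
  "monomial (cycle_type n es xs) = (\<Prod>x\<in>set (cycle_vars n es xs).
     indet x ^ (count_list (cycle_vars n es xs) x div var_index x))"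
proof -
  let ?ts = "cycle_vars n es xs"
  let ?f = "\<lambda>p. indet (fst p) ^ (snd p div var_index (fst p))"
  have "monomial (cycle_type n es xs) =
    prod_list (map ?f (sort_key (\<lambda>p. var_rank (fst p)) (tally ?ts)))"
    by (simp add: monomial_def cycle_type_def comp_def case_prod_unfold)
  \<comment> \<open>A product depends only on the multiset of its factors, which sorting
    preserves.\<close>
  also have "\<dots> = prod_list (map ?f (tally ?ts))"
    by (simp flip: prod_mset_prod_list)
  also have "\<dots> = (\<Prod>x\<in>set ?ts. indet x ^ (count_list ?ts x div var_index x))"
    by (simp add: tally_def comp_def prod.distinct_set_conv_list[symmetric])
  finally show ?thesis .
qed

section \<open>Edge lists and the enumeration of partial embeddings\<close>

definition edge_list :: "nat \<Rightarrow> (nat \<Rightarrow> nat \<Rightarrow> bool) \<Rightarrow> (nat \<times> nat) list" where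
  "edge_list n adj =
     concat (map (\<lambda>j. map (\<lambda>i. (i, j)) (filter (\<lambda>i. adj i j) [0..<j])) [0..<n])"

lemma set_edge_list: "set (edge_list n adj) = {(i, j). i < j \<and> j < n \<and> adj i j}"
  by (auto simp: edge_list_def)

lemma distinct_concat_map:
  assumes "distinct xs" and "\<And>x. x \<in> set xs \<Longrightarrow> distinct (f x)"
    and "\<And>x y. x \<in> set xs \<Longrightarrow> y \<in> set xs \<Longrightarrow> x \<noteq> y \<Longrightarrow> set (f x) \<inter> set (f y) = {}"
  shows "distinct (concat (map f xs))"
  using assms
proof (induction xs)
  case (Cons x xs)
  have "set (f x) \<inter> set (f y) = {}" if "y \<in> set xs" for y
    using Cons.prems(1) that by (intro Cons.prems(3)) auto
  then show ?case using Cons by auto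
qed simp

lemma distinct_edge_list: "distinct (edge_list n adj)"
  unfolding edge_list_def by (rule distinct_concat_map) (auto simp: distinct_map inj_on_def)

text \<open>The lists of images of \<open>0, \<dots>, k - 1\<close> under the isomorphisms between induced subgraphs.\<close>

fun embeddings :: "nat \<Rightarrow> (nat \<Rightarrow> nat \<Rightarrow> bool) \<Rightarrow> nat \<Rightarrow> nat list list" where
  "embeddings n adj 0 = [[]]"
| "embeddings n adj (Suc k) = concat (map (\<lambda>xs. map (\<lambda>y. xs @ [y])
     (filter (\<lambda>y. y \<notin> set xs \<and> (\<forall>i\<in>set [0..<k]. adj (xs ! i) y = adj i k)) [0..<n]))
     (embeddings n adj k))"

lemma distinct_embeddings: "distinct (embeddings n adj k)"
proof (induction k)
  case (Suc k)
  show ?case unfolding embeddings.simps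
    by (rule distinct_concat_map[OF Suc.IH]) (auto simp: distinct_map inj_on_def)
qed simp

text \<open>Every prefix of a valid list is valid, so pruning loses nothing; conversely, the only
  new conditions at length \<open>k + 1\<close> concern the last entry, and the filter tests exactly
  these.\<close>

lemma set_embeddings:
  "set (embeddings n adj k) = {xs. length xs = k \<and> distinct xs \<and> set xs \<subseteq> {..<n} \<and>
     (\<forall>j<k. \<forall>i<j. adj (xs ! i) (xs ! j) = adj i j)}"
proof (induction k)
  case (Suc k)
  show ?case
  proof (intro set_eqI iffI)
    fix zs assume "zs \<in> set (embeddings n adj (Suc k))"
    then obtain xs y where zs: "zs = xs @ [y]" and "xs \<in> set (embeddings n adj k)"
      and y: "y < n" "y \<notin> set xs" "\<And>i. i < k \<Longrightarrow> adj (xs ! i) y = adj i k" by auto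
    then have xs: "length xs = k" "distinct xs" "set xs \<subseteq> {..<n}"
      "\<And>i j. j < k \<Longrightarrow> i < j \<Longrightarrow> adj (xs ! i) (xs ! j) = adj i j" unfolding Suc.IH by auto
    have "adj (zs ! i) (zs ! j) = adj i j" if "j < Suc k" "i < j" for i j
    proof (cases "j = k")
      case True
      then show ?thesis using that xs(1) y(3)[of i] by (simp add: zs nth_append)
    next
      case False
      then show ?thesis using that xs(1) xs(4)[of j i] by (simp add: zs nth_append)
    qed
    then show "zs \<in> {xs. length xs = Suc k \<and> distinct xs \<and> set xs \<subseteq> {..<n} \<and>
        (\<forall>j<Suc k. \<forall>i<j. adj (xs ! i) (xs ! j) = adj i j)}"
      using xs(1-3) y(1,2) zs by simp
  next
    fix zs assume zs: "zs \<in> {xs. length xs = Suc k \<and> distinct xs \<and> set xs \<subseteq> {..<n} \<and>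
        (\<forall>j<Suc k. \<forall>i<j. adj (xs ! i) (xs ! j) = adj i j)}"
    then obtain xs y where xy: "zs = xs @ [y]" "length xs = k"
      by (metis (mono_tags, lifting) length_Suc_conv_rev mem_Collect_eq)
    have adj: "adj (zs ! i) (zs ! j) = adj i j" if "j < Suc k" "i < j" for i j
      using zs that by blast
    have "adj (xs ! i) (xs ! j) = adj i j" if "j < k" "i < j" for i j
      using adj[of j i] that xy by (simp add: nth_append)
    moreover have y: "distinct xs" "set xs \<subseteq> {..<n}" "y \<notin> set xs" "y < n" using zs xy(1) by auto
    ultimately have "xs \<in> set (embeddings n adj k)" unfolding Suc.IH using xy(2) by simp
    moreover have "adj (xs ! i) y = adj i k" if "i < k" for i
      using adj[of k i] that xy by (simp add: nth_append)
    ultimately show "zs \<in> set (embeddings n adj (Suc k))"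
      using y by (auto simp: xy(1) intro!: bexI[of _ xs])
  qed
qed auto

section \<open>Labelled graphs and their automorphism groups\<close>

locale labelled_graph =
  fixes lab :: "nat \<Rightarrow> 'v" and n :: nat and adj :: "nat \<Rightarrow> nat \<Rightarrow> bool"
  assumes inj_lab: "inj_on lab {..<n}"
    and adj_sym: "adj i j \<longleftrightarrow> adj j i"
    and adj_irrefl: "\<not> adj i i"
begin

definition G :: "'v graph" where
  "G = Graph (lab ` {..<n}) {{lab i, lab j} | i j. i < n \<and> j < n \<and> adj i j}"

text \<open>The identity outside the labelled vertices, as \<open>Aut\<close> represents an
  automorphism by a permutation of the whole type.\<close>

definition perm :: "nat list \<Rightarrow> 'v \<Rightarrow> 'v" where
  "perm xs v = (if v \<in> lab ` {..<n} then lab (xs ! the_inv_into {..<n} lab v) else v)"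

lemma verts_G: "verts G = lab ` {..<n}"
  by (simp add: G_def)

lemma lab_eq_iff: "i < n \<Longrightarrow> j < n \<Longrightarrow> lab i = lab j \<longleftrightarrow> i = j"
  using inj_lab by (auto simp: inj_on_def)

lemma edges_G: "edges G = (\<lambda>(i, j). {lab i, lab j}) ` set (edge_list n adj)"
proof -
  have "\<exists>i' j'. i' < j' \<and> j' < n \<and> adj i' j' \<and> {lab i, lab j} = {lab i', lab j'}"
    if "i < n" "j < n" "adj i j" for i j
  proof (cases "i < j")
    case False
    then have "j < i" using that adj_irrefl[of j] by (cases "i = j") auto
    then show ?thesis using that adj_sym[of i j] by (intro exI[of _ j] exI[of _ i]) auto
  qed (use that in blast)
  then show ?thesis by (fastforce simp: G_def set_edge_list)
qed

lemma edge_iff: "i < n \<Longrightarrow> j < n \<Longrightarrow> {lab i, lab j} \<in> edges G \<longleftrightarrow> adj i j"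
  using adj_sym by (auto simp: G_def doubleton_eq_iff lab_eq_iff)

lemma perm_lab: "i < n \<Longrightarrow> perm xs (lab i) = lab (xs ! i)"
  by (simp add: perm_def the_inv_into_f_f[OF inj_lab])

lemma perm_permutes:
  assumes "length xs = n" and "distinct xs" and "set xs \<subseteq> {..<n}"
  shows "perm xs permutes verts G"
proof (rule bij_imp_permutes)
  have lt: "xs ! i < n" if "i < n" for i using that assms(1,3) nth_mem by blast
  have "perm xs ` verts G \<subseteq> verts G" using lt by (auto simp: verts_G perm_lab)
  moreover have "inj_on (perm xs) (verts G)"
    using lt assms(1,2) by (auto simp: verts_G inj_on_def perm_lab lab_eq_iff nth_eq_iff_index_eq)
  ultimately show "bij_betw (perm xs) (verts G) (verts G)"
    unfolding bij_betw_def by (metis endo_inj_surj finite_imageI finite_lessThan verts_G)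
qed (simp add: perm_def verts_G)

lemma nth_less: "xs \<in> set (embeddings n adj n) \<Longrightarrow> i < n \<Longrightarrow> xs ! i < n"
  using nth_mem unfolding set_embeddings by blast

lemma perm_in_Aut:
  assumes "xs \<in> set (embeddings n adj n)"
  shows "perm xs \<in> Aut G"
proof -
  have xs: "length xs = n" "distinct xs" "set xs \<subseteq> {..<n}"
    and adj: "\<And>i j. j < n \<Longrightarrow> i < j \<Longrightarrow> adj (xs ! i) (xs ! j) = adj i j"
    using assms unfolding set_embeddings by auto
  note lt = nth_less[OF assms]
  \<comment> \<open>The enumeration tests only pairs \<open>i < j\<close>; symmetry and
    irreflexivity of \<open>adj\<close> supply the others.\<close>
  have "adj (xs ! i) (xs ! j) = adj i j" if "i < n" "j < n" for i j
    using adj[of j i] adj[of i j] that adj_irrefl adj_sym by (cases i j rule: linorder_cases) auto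
  then show ?thesis
    unfolding Aut_def using perm_permutes[OF xs] lt
    by (auto simp: verts_G perm_lab edge_iff)
qed

text \<open>Conjugating an automorphism by the labelling gives a map of the labels whose list of
  values passes all tests of the enumeration.\<close>

lemma Aut_eq: "Aut G = perm ` set (embeddings n adj n)"
proof (intro equalityI subsetI)
  fix \<sigma> assume "\<sigma> \<in> Aut G"
  then have perm: "\<sigma> permutes lab ` {..<n}"
    and edge: "\<And>i j. i < n \<Longrightarrow> j < n \<Longrightarrow>
      {lab i, lab j} \<in> edges G \<longleftrightarrow> {\<sigma> (lab i), \<sigma> (lab j)} \<in> edges G"
    unfolding Aut_def verts_G by auto
  define p where "p = (\<lambda>i. the_inv_into {..<n} lab (\<sigma> (lab i)))"
  have "\<sigma> (lab i) \<in> lab ` {..<n}" if "i < n" for i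
    using permutes_in_image[OF perm] that by auto
  then have p: "lab (p i) = \<sigma> (lab i)" "p i < n" if "i < n" for i
    using that f_the_inv_into_f[OF inj_lab] the_inv_into_into[OF inj_lab, of _ "{..<n}"]
    unfolding p_def by auto
  have "inj_on p {..<n}"
  proof (rule inj_onI)
    fix i j assume "i \<in> {..<n}" "j \<in> {..<n}" "p i = p j"
    then show "i = j" using p(1)[of i] p(1)[of j] injD[OF permutes_inj[OF perm], of "lab i" "lab j"]
      by (simp add: lab_eq_iff)
  qed
  moreover have "adj (p i) (p j) = adj i j" if "i < n" "j < n" for i j
    using edge[OF that] edge_iff[OF that] edge_iff[of "p i" "p j"] p that by simp
  ultimately have "map p [0..<n] \<in> set (embeddings n adj n)"
    unfolding set_embeddings using p(2) by (auto simp: distinct_map atLeast0LessThan)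
  moreover have "perm (map p [0..<n]) = \<sigma>"
  proof
    fix v show "perm (map p [0..<n]) v = \<sigma> v"
    proof (cases "v \<in> lab ` {..<n}")
      case True
      then obtain i where "i < n" "v = lab i" by auto
      then show ?thesis using p(1)[of i] by (simp add: perm_lab)
    next
      case False
      then show ?thesis using permutes_not_in[OF perm] by (simp add: perm_def)
    qed
  qed
  ultimately show "\<sigma> \<in> perm ` set (embeddings n adj n)" by blast
qed (use perm_in_Aut in blast)

text \<open>With \<open>Aut_eq\<close> this makes the enumeration a bijection onto the group, as
  needed both for its order and for the sum over it.\<close>

lemma inj_on_perm: "inj_on perm (set (embeddings n adj n))"
proof (rule inj_onI)
  fix xs ys assume xs: "xs \<in> set (embeddings n adj n)" and ys: "ys \<in> set (embeddings n adj n)"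
    and eq: "perm xs = perm ys"
  have len: "length xs = n" "length ys = n"
    using xs ys unfolding set_embeddings by auto
  have "xs ! i = ys ! i" if "i < n" for i
  proof -
    have "xs ! i < n" "ys ! i < n" using that nth_less[OF xs] nth_less[OF ys] by simp_all
    then show ?thesis
      using that fun_cong[OF eq, of "lab i"] by (simp add: perm_lab lab_eq_iff)
  qed
  then show "xs = ys" using len by (intro nth_equalityI) auto
qed

section \<open>The cycles and the weight of a single automorphism\<close>

context
  fixes xs assumes xs: "xs \<in> set (embeddings n adj n)"
begin

lemma funpow_nth_less: "i < n \<Longrightarrow> (((!) xs) ^^ k) i < n"
  by (induction k) (simp_all add: nth_less[OF xs])

lemma funpow_perm: "i < n \<Longrightarrow> (perm xs ^^ k) (lab i) = lab ((((!) xs) ^^ k) i)"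
  by (induction k) (simp_all add: perm_lab funpow_nth_less)

lemma inj_perm: "inj (perm xs)"
  using perm_in_Aut[OF xs] permutes_inj unfolding Aut_def by blast

lemma perm_vertex: "v \<in> verts G \<Longrightarrow> perm xs v \<in> verts G"
  by (auto simp: verts_G perm_lab nth_less[OF xs])

lemma perm_edge:
  assumes "e \<in> edges G"
  shows "perm xs ` e \<in> edges G"
proof -
  obtain i j where "i < n" "j < n" "e = {lab i, lab j}"
    using assms by (auto simp: G_def)
  with assms show ?thesis using perm_in_Aut[OF xs] unfolding Aut_def by (auto simp: verts_G)
qed

lemma inj_image_perm: "inj ((`) (perm xs))"
  using inj_perm by (simp add: inj_on_def inj_image_eq_iff)

lemma finite_edges_G: "finite (edges G)"
  by (simp add: edges_G)

text \<open>Labels and vertices return at the same steps, and an orbit has at most \<open>n\<close>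
  vertices, so the bounded search finds the orbit length.\<close>

lemma vertex_var:
  assumes "v < n"
  shows "vertex_var n ((!) xs) v = Var_a (card (orbit (perm xs) (lab v)))"
proof -
  let ?l = "card (orbit (perm xs) (lab v))" and ?P = "\<lambda>w. w = v"
  have self: "lab v \<in> orbit (perm xs) (lab v)"
    using self_in_orbit_finite[OF inj_perm _ _ perm_vertex, of "lab v"] assms by (simp add: verts_G)
  have iff: "(perm xs ^^ k) (lab v) = lab v \<longleftrightarrow> (((!) xs) ^^ k) v = v" for k
    using assms by (simp add: funpow_perm funpow_nth_less lab_eq_iff)
  have "orbit (perm xs) (lab v) \<subseteq> verts G"
    using orbit_subset_invariant[OF _ perm_vertex] assms by (simp add: verts_G)
  then have "?l \<le> card (lab ` {..<n})" using card_mono[of "verts G"] by (simp add: verts_G)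
  also have "\<dots> \<le> n" using card_image_le[of "{..<n}" lab] by simp
  finally have "?l \<le> n" .
  note rt = return_time[of ?P ?l "(!) xs" v n, OF _ funpow_card_orbit(1)[OF self] this]
  have "?l = return_time ?P ((!) xs) n v"
    using rt funpow_card_orbit(2)[OF self] by (intro card_orbit_eqI) (simp_all add: iff)
  then show ?thesis by (simp add: vertex_var_def)
qed

text \<open>For \<open>l\<close> the length of the cycle, the \<open>l\<close>-th power of the
  permutation fixes or exchanges the ends of the first edge. This power commutes with the
  permutation, which carries the first edge to all others, so the whole cycle behaves alike and
  testing \<open>u\<close> suffices.\<close>

lemma edge_var:
  assumes "(u, v) \<in> set (edge_list n adj)"
  defines "c \<equiv> orbit ((`) (perm xs)) {lab u, lab v}"
  shows "edge_var (length (edge_list n adj)) ((!) xs) (u, v) =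
      (if cylindrical (perm xs) c then Var_b (card c) else Var_c (card c))"
    and "moebius (perm xs) c \<longleftrightarrow> \<not> cylindrical (perm xs) c"
proof -
  let ?f = "(!) xs" and ?m = "length (edge_list n adj)" and ?e = "{lab u, lab v}"
  let ?F = "map_prod ?f ?f" and ?P = "\<lambda>e. e = (u, v) \<or> e = (v, u)" and ?l = "card c"
  have uv: "u < n" "v < n" "u \<noteq> v" using assms(1) by (auto simp: set_edge_list)
  have e: "?e \<in> edges G" using assms(1) by (force simp: edges_G)
  have self: "?e \<in> c" unfolding c_def
    using self_in_orbit_finite[OF inj_image_perm finite_edges_G e perm_edge] .
  have funpow_F: "(?F ^^ k) (u, v) = ((?f ^^ k) u, (?f ^^ k) v)" for k
    by (induction k) simp_all
  \<comment> \<open>A two-element set returns exactly when the ordered pair returns up to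
    reversal.\<close>
  have iff: "(((`) (perm xs)) ^^ k) ?e = ?e \<longleftrightarrow> ?P ((?F ^^ k) (u, v))" for k
    using uv by (auto simp: funpow_image funpow_F funpow_perm doubleton_eq_iff
      lab_eq_iff funpow_nth_less)
  have "c \<subseteq> edges G" unfolding c_def using orbit_subset_invariant[OF e perm_edge] .
  then have "?l \<le> card (edges G)" using card_mono finite_edges_G by blast
  also have "\<dots> \<le> ?m"
    unfolding edges_G using card_image_le[of "set (edge_list n adj)"] card_length order_trans by blast
  finally have m: "?l \<le> ?m" .
  note l = funpow_card_orbit[OF self[unfolded c_def], folded c_def]
  have "?P ((?F ^^ ?l) (u, v))" using l(2) unfolding iff .
  note rt = return_time[of ?P ?l ?F "(u, v)" ?m, OF this l(1) m]
  have ret: "?l = return_time ?P ?F ?m (u, v)"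
    unfolding c_def
  proof (rule card_orbit_eqI)
    show "(((`) (perm xs)) ^^ return_time ?P ?F ?m (u, v)) ?e = ?e" unfolding iff by (rule rt(2))
    show "(((`) (perm xs)) ^^ j) ?e \<noteq> ?e" if "0 < j" "j < return_time ?P ?F ?m (u, v)" for j
      unfolding iff using that by (rule rt(3))
  qed (rule rt(1))
  let ?s = "perm xs ^^ ?l"
  have uv_l: "?s (lab u) = lab u \<and> ?s (lab v) = lab v \<or> ?s (lab u) = lab v \<and> ?s (lab v) = lab u"
    using l(2) by (auto simp: funpow_image doubleton_eq_iff)
  have ne: "lab u \<noteq> lab v" using uv by (simp add: lab_eq_iff)
  have c_elem: "\<exists>k. d = {(perm xs ^^ k) (lab u), (perm xs ^^ k) (lab v)}" if "d \<in> c" for d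
    using that unfolding c_def orbit_altdef by (auto simp: funpow_image)
  have comm: "?s ((perm xs ^^ k) x) = (perm xs ^^ k) (?s x)" for k x
    by (metis add.commute comp_apply funpow_add)
  have cyl: "cylindrical (perm xs) c \<longleftrightarrow> ?s (lab u) = lab u"
  proof
    assume "cylindrical (perm xs) c"
    then show "?s (lab u) = lab u" using self by (auto simp: cylindrical_def)
  next
    assume "?s (lab u) = lab u"
    then have "?s (lab u) = lab u" "?s (lab v) = lab v" using uv_l ne by auto
    then show "cylindrical (perm xs) c"
      unfolding cylindrical_def using c_elem by (fastforce simp: comm)
  qed
  have moeb: "moebius (perm xs) c \<longleftrightarrow> ?s (lab u) \<noteq> lab u"
  proof
    assume "moebius (perm xs) c"
    then obtain a b where "a \<noteq> b" "?e = {a, b}" "?s a = b" "?s b = a"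
      using self unfolding moebius_def by blast
    then show "?s (lab u) \<noteq> lab u" by (auto simp: doubleton_eq_iff)
  next
    assume "?s (lab u) \<noteq> lab u"
    then have sw: "?s (lab u) = lab v" "?s (lab v) = lab u" using uv_l by auto
    show "moebius (perm xs) c"
      unfolding moebius_def
    proof
      fix d assume "d \<in> c"
      then obtain k where k: "d = {(perm xs ^^ k) (lab u), (perm xs ^^ k) (lab v)}"
        using c_elem by blast
      have "(perm xs ^^ k) (lab u) \<noteq> (perm xs ^^ k) (lab v)"
        using ne injD[OF inj_fn[OF inj_perm]] by blast
      then show "\<exists>a b. a \<noteq> b \<and> d = {a, b} \<and> ?s a = b \<and> ?s b = a"
        using k sw by (intro exI[of _ "(perm xs ^^ k) (lab u)"] exI[of _ "(perm xs ^^ k) (lab v)"])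
          (simp add: comm)
    qed
  qed
  show "moebius (perm xs) c \<longleftrightarrow> \<not> cylindrical (perm xs) c" using cyl moeb by simp
  have "?s (lab u) = lab u \<longleftrightarrow> (?f ^^ ?l) u = u"
    using uv by (simp add: funpow_perm funpow_nth_less lab_eq_iff)
  then show "edge_var ?m ?f (u, v) =
      (if cylindrical (perm xs) c then Var_b (card c) else Var_c (card c))"
    by (simp add: edge_var_def ret[symmetric] cyl Let_def)
qed

lemma inj_on_edge: "inj_on (\<lambda>(i, j). {lab i, lab j}) (set (edge_list n adj))"
  by (auto simp: inj_on_def set_edge_list doubleton_eq_iff lab_eq_iff)

text \<open>Moves the count of edges in \<open>card_cycles_of_length\<close> to the listed pairs on
  which \<open>edge_var\<close> is evaluated.\<close>

lemma card_edges_orbit: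
  "card {e \<in> edges G. R (orbit ((`) (perm xs)) e)} =
    card {(u, v) \<in> set (edge_list n adj). R (orbit ((`) (perm xs)) {lab u, lab v})}"
proof -
  let ?A = "{(u, v) \<in> set (edge_list n adj). R (orbit ((`) (perm xs)) {lab u, lab v})}"
  have "{e \<in> edges G. R (orbit ((`) (perm xs)) e)} = (\<lambda>(i, j). {lab i, lab j}) ` ?A"
    by (auto simp: edges_G)
  moreover have "inj_on (\<lambda>(i, j). {lab i, lab j}) ?A"
    by (rule inj_on_subset[OF inj_on_edge]) auto
  ultimately show ?thesis by (simp only: card_image)
qed

abbreviation "vars \<equiv> cycle_vars n (edge_list n adj) xs"

lemma count_vars:
  "count_list vars y = card {v \<in> {..<n}. vertex_var n ((!) xs) v = y} +
    card {e \<in> set (edge_list n adj). edge_var (length (edge_list n adj)) ((!) xs) e = y}"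
  by (simp add: cycle_vars_def count_list_append count_list_map_card distinct_edge_list
    atLeast0LessThan)

lemma edge_var_ne_Var_a: "edge_var m f e \<noteq> Var_a k"
  by (simp add: edge_var_def Let_def split: prod.split)

lemma cyc_count: "cyc_count G (perm xs) k = count_list vars (Var_a k) div k"
proof -
  let ?A = "{v \<in> {..<n}. vertex_var n ((!) xs) v = Var_a k}"
  have "{x \<in> verts G. card (orbit (perm xs) x) = k} = lab ` ?A"
    by (auto simp: verts_G vertex_var)
  moreover have "card (lab ` ?A) = card ?A"
    by (rule card_image[OF inj_on_subset[OF inj_lab]]) auto
  ultimately have "card {x \<in> verts G. card (orbit (perm xs) x) = k} = count_list vars (Var_a k)"
    by (simp add: count_vars edge_var_ne_Var_a)
  then show ?thesis
    using card_cycles_of_length[OF inj_perm _ perm_vertex, of k "\<lambda>_. True"]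
    by (simp add: cyc_count_def vertex_cycles_def verts_G)
qed

lemma cyl_count: "cyl_count G (perm xs) k = count_list vars (Var_b k) div k"
proof -
  have "count_list vars (Var_b k) =
    card {(u, v) \<in> set (edge_list n adj).
      card (orbit ((`) (perm xs)) {lab u, lab v}) = k \<and>
      cylindrical (perm xs) (orbit ((`) (perm xs)) {lab u, lab v})}"
    by (auto simp: count_vars vertex_var_def edge_var(1) intro!: arg_cong[of _ _ card] split: if_splits)
  then show ?thesis
    using card_cycles_of_length[OF inj_image_perm finite_edges_G perm_edge, of k "cylindrical (perm xs)"]
      card_edges_orbit[of "\<lambda>c. card c = k \<and> cylindrical (perm xs) c"]
    by (simp add: cyl_count_def edge_cycles_def)
qed

lemma moeb_count: "moeb_count G (perm xs) k = count_list vars (Var_c k) div k"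
proof -
  have "count_list vars (Var_c k) =
    card {(u, v) \<in> set (edge_list n adj).
      card (orbit ((`) (perm xs)) {lab u, lab v}) = k \<and>
      moebius (perm xs) (orbit ((`) (perm xs)) {lab u, lab v})}"
    by (auto simp: count_vars vertex_var_def edge_var intro!: arg_cong[of _ _ card] split: if_splits)
  then show ?thesis
    using card_cycles_of_length[OF inj_image_perm finite_edges_G perm_edge, of k "moebius (perm xs)"]
      card_edges_orbit[of "\<lambda>c. card c = k \<and> moebius (perm xs) c"]
    by (simp add: moeb_count_def edge_cycles_def)
qed

text \<open>The product over all \<open>k\<close> is cut down to the indices that occur, then
  reordered as one product over variables.\<close>

lemma cycle_weight_perm:
  "cycle_weight G (perm xs) = monomial (cycle_type n (edge_list n adj) xs)"
proof -
  define h where "h = (\<lambda>x. indet x ^ (count_list vars x div var_index x))"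
  define K where "K = var_index ` set vars"
  have h1: "h x = 1" if "x \<notin> set vars" for x
    using that count_list_0_iff[of vars x] by (simp add: h_def)
  have K: "x \<notin> set vars" if "var_index x \<notin> K" for x using that by (auto simp: K_def)
  have fin: "finite K" by (simp add: K_def)
  have "cycle_weight G (perm xs) = (\<Prod>k. h (Var_a k) * h (Var_b k) * h (Var_c k))"
    by (simp add: cycle_weight_def \<a>_def \<b>_def \<c>_def cyc_count cyl_count moeb_count h_def)
  \<comment> \<open>At an index outside \<open>K\<close> all three exponents are 0, so the factor is
    1.\<close>
  also have "\<dots> = (\<Prod>k\<in>K. h (Var_a k) * h (Var_b k) * h (Var_c k))"
  proof (rule Prod_any.expand_superset[OF fin], rule subsetI, rule ccontr)
    fix k assume k: "k \<in> {k. h (Var_a k) * h (Var_b k) * h (Var_c k) \<noteq> 1}" "k \<notin> K"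
    then show False using h1[OF K, of "Var_a k"] h1[OF K, of "Var_b k"] h1[OF K, of "Var_c k"] by simp
  qed
  also have "\<dots> = prod h (Var_a ` K) * prod h (Var_b ` K) * prod h (Var_c ` K)"
    by (simp add: prod.distrib prod.reindex inj_on_def)
  also have "\<dots> = prod h (Var_a ` K \<union> Var_b ` K \<union> Var_c ` K)"
    using fin by (subst prod.union_disjoint; (subst prod.union_disjoint)?) auto
  \<comment> \<open>A variable may be absent although its index occurs in another family; its
    exponent is 0 and it contributes 1.\<close>
  also have "\<dots> = prod h (set vars)"
  proof (rule prod.mono_neutral_right)
    show "set vars \<subseteq> Var_a ` K \<union> Var_b ` K \<union> Var_c ` K"
    proof
      fix x assume "x \<in> set vars"
      then have "var_index x \<in> K" by (simp add: K_def)
      then show "x \<in> Var_a ` K \<union> Var_b ` K \<union> Var_c ` K" by (cases x) auto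
    qed
  qed (use fin h1 in auto)
  finally show ?thesis by (simp add: monomial_cycle_type h_def)
qed

end

text \<open>The evaluated table enters as \<open>T\<close>. It yields the group order too, as the
  total multiplicity of its rows.\<close>

theorem walsh_index_G:
  assumes "tally (map (cycle_type n (edge_list n adj)) (embeddings n adj n)) = T"
  shows "walsh_index G = const (1 / of_nat (sum_list (map snd T))) *
    (\<Sum>(t, k)\<leftarrow>T. of_nat k * monomial t)"
proof -
  let ?L = "embeddings n adj n"
  have "card (Aut G) = length ?L"
    by (simp add: Aut_eq card_image inj_on_perm distinct_card distinct_embeddings)
  also have "\<dots> = sum_list (map snd T)"
    unfolding assms[symmetric] length_tally by simp
  finally have "card (Aut G) = sum_list (map snd T)" .
  moreover have "(\<Sum>\<sigma>\<in>Aut G. cycle_weight G \<sigma>) =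
      (\<Sum>(t, k)\<leftarrow>T. of_nat k * monomial t)"
  proof -
    have "(\<Sum>\<sigma>\<in>Aut G. cycle_weight G \<sigma>) =
        (\<Sum>xs\<in>set ?L. monomial (cycle_type n (edge_list n adj) xs))"
      by (simp add: Aut_eq sum.reindex inj_on_perm cycle_weight_perm)
    also have "\<dots> = sum_list (map monomial (map (cycle_type n (edge_list n adj)) ?L))"
      by (simp add: sum.distinct_set_conv_list distinct_embeddings comp_def)
    also note sum_list_tally
    finally show ?thesis unfolding assms .
  qed
  ultimately show ?thesis by (simp only: walsh_index_def)
qed

end


section \<open>The two cores as labelled graphs\<close>

text \<open>The labels \<open>0\<close> and \<open>1\<close> are the ends of the edge of identification, which is present iff \<open>b\<close>;
  \<open>2, 3, 4\<close> and \<open>5, 6, 7\<close> are the remaining vertices of the two copies of \<open>K\<^sub>5\<close>.\<close>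

definition core_adj :: "bool \<Rightarrow> nat \<Rightarrow> nat \<Rightarrow> bool" where
  "core_adj b i j \<longleftrightarrow> i \<noteq> j \<and> (if i < 2 \<and> j < 2 then b else i < 2 \<or> j < 2 \<or> (i < 5 \<longleftrightarrow> j < 5))"

lemma complete_graph_image:
  assumes "inj_on f I"
  shows "edges (complete_graph (f ` I)) = {{f i, f j} | i j. i \<in> I \<and> j \<in> I \<and> i \<noteq> j}"
proof -
  have "\<exists>i j. e = {f i, f j} \<and> i \<in> I \<and> j \<in> I \<and> i \<noteq> j" if sub: "e \<subseteq> f ` I" and card: "card e = 2" for e
  proof -
    obtain x y where e: "e = {x, y}" "x \<noteq> y" using card by (auto simp: card_2_iff)
    then obtain i j where "i \<in> I" "j \<in> I" "x = f i" "y = f j" using sub by auto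
    then show ?thesis using e by blast
  qed
  moreover have "card {f i, f j} = 2" if "i \<in> I" "j \<in> I" "i \<noteq> j" for i j
    using that assms by (auto simp: inj_on_def card_2_iff)
  ultimately show ?thesis by (auto simp: complete_graph_def)
qed

text \<open>By \<open>core_M_altdef\<close> the second copy has \<open>p1\<close>, \<open>p2\<close>
  in place of \<open>q1\<close>, \<open>q2\<close>, so labels 0 and 1 belong to both copies. One
  labelling serves both cores.\<close>

lemma core_labelling:
  assumes "disjoint_K5s P p Q q"
  obtains lab where "labelled_graph lab 8 (core_adj True)"
    and "labelled_graph lab 8 (core_adj False)"
    and "core_M P p Q q = labelled_graph.G lab 8 (core_adj True)"
    and "core_M_star P p Q q = labelled_graph.G lab 8 (core_adj False)"
proof -
  obtain p1 p2 q1 q2 where pq: "p = (p1, p2)" "q = (q1, q2)" by (cases p, cases q) auto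
  from assms have c: "card P = 5" "card Q = 5" and disj: "P \<inter> Q = {}"
    and p: "p1 \<in> P" "p2 \<in> P" "p1 \<noteq> p2" and q: "q1 \<in> Q" "q2 \<in> Q" "q1 \<noteq> q2"
    unfolding disjoint_K5s_def complete_graph_def pq by (auto simp: card_2_iff doubleton_eq_iff)
  have fin: "finite P" "finite Q" using c by (auto intro: card_ge_0_finite)
  have "card (P - {p1, p2}) = 3" "card (Q - {q1, q2}) = 3"
    using c p q fin by (simp_all add: card_Diff_subset)
  then obtain x1 x2 x3 y1 y2 y3 where x: "P - {p1, p2} = {x1, x2, x3}" "distinct [x1, x2, x3]"
    and y: "Q - {q1, q2} = {y1, y2, y3}" "distinct [y1, y2, y3]"
    by (auto simp: card_3_iff)
  define lab where "lab = (!) [p1, p2, x1, x2, x3, y1, y2, y3]"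
  define I J :: "nat set" where "I = {0, 1, 2, 3, 4}" and "J = {0, 1, 5, 6, 7}"
  have "distinct [p1, p2, x1, x2, x3, y1, y2, y3]" using x y p disj by auto
  then have inj: "inj_on lab {..<8}"
    unfolding lab_def by (intro inj_on_nth) auto
  have PI: "lab ` I = P" using x(1) p by (auto simp: lab_def I_def)
  have QJ: "lab ` J = Q - {q1, q2} \<union> {p1, p2}" unfolding y(1) by (auto simp: lab_def J_def)
  have IJ: "I \<subseteq> {..<8}" "J \<subseteq> {..<8}" "I \<union> J = {..<8}" by (auto simp: I_def J_def)
  have labelled: "labelled_graph lab 8 (core_adj b)" for b
    using inj by unfold_locales (auto simp: core_adj_def)
  interpret M: labelled_graph lab 8 "core_adj True" by (rule labelled)
  interpret M': labelled_graph lab 8 "core_adj False" by (rule labelled)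
  \<comment> \<open>Two distinct labels are adjacent in the first core iff a common copy,
    \<open>I\<close> or \<open>J\<close>, contains both.\<close>
  have adj: "core_adj True i j \<longleftrightarrow> i \<noteq> j \<and> (i \<in> I \<and> j \<in> I \<or> i \<in> J \<and> j \<in> J)"
    if "i < 8" "j < 8" for i j
  proof -
    have "k \<in> I \<longleftrightarrow> k < 5" "k \<in> J \<longleftrightarrow> k < 2 \<or> 5 \<le> k" if "k < 8" for k
      using that by (auto simp: I_def J_def)
    then show ?thesis using that by (auto simp: core_adj_def)
  qed
  have M: "core_M P p Q q = graph_union (complete_graph (lab ` I)) (complete_graph (lab ` J))"
    using core_M_altdef[OF assms[unfolded pq]] unfolding pq PI QJ .
  have "verts (core_M P p Q q) = lab ` {..<8}"
    unfolding M graph_union_def complete_graph_def by (simp flip: image_Un IJ(3))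
  moreover have "edges (core_M P p Q q) = {{lab i, lab j} | i j. i < 8 \<and> j < 8 \<and> core_adj True i j}"
  proof -
    have "edges (core_M P p Q q) = {{lab i, lab j} | i j. i \<in> I \<and> j \<in> I \<and> i \<noteq> j} \<union>
        {{lab i, lab j} | i j. i \<in> J \<and> j \<in> J \<and> i \<noteq> j}"
      unfolding M graph_union_def by (simp add: complete_graph_image inj_on_subset[OF inj] IJ)
    also have "\<dots> = {{lab i, lab j} | i j. i < 8 \<and> j < 8 \<and> core_adj True i j}"
      using adj IJ(1,2) by blast
    finally show ?thesis .
  qed
  ultimately have G: "core_M P p Q q = M.G"
    unfolding M.G_def by (cases "core_M P p Q q") simp
  \<comment> \<open>The deleted edge is the only one with both labels below 2, which is where the
    two adjacencies differ.\<close>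
  have star: "edges M.G - {{lab 0, lab 1}} = edges M'.G"
  proof -
    have "{lab i, lab j} = {lab 0, lab 1} \<longleftrightarrow> i < 2 \<and> j < 2" if "i < 8" "j < 8" "i \<noteq> j" for i j
      using that M.lab_eq_iff[of i 0] M.lab_eq_iff[of i 1] M.lab_eq_iff[of j 0] M.lab_eq_iff[of j 1]
      by (auto simp: doubleton_eq_iff)
    moreover have "core_adj False i j \<longleftrightarrow> core_adj True i j \<and> \<not> (i < 2 \<and> j < 2)" 
      "core_adj True i j \<Longrightarrow> i \<noteq> j" for i j
      by (auto simp: core_adj_def)
    ultimately show ?thesis unfolding M.G_def M'.G_def graph.sel by blast
  qed
  have "core_M_star P p Q q = delete_edge M.G {lab 0, lab 1}"
    unfolding core_M_star_def G by (simp add: pq lab_def)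
  also have "\<dots> = M'.G"
    unfolding delete_edge_def star by (simp add: M.G_def M'.G_def)
  finally show ?thesis by (rule that[OF labelled labelled G])
qed

section \<open>Evaluation of the cycle types and the two series\<close>

text \<open>The group is the product of the swap of 0 and 1 with the wreath product of
  \<open>S_3\<close> by \<open>S_2\<close>, of order 72. The first nine rows fix 0 and 1; the last
  nine are their composites with the swap, in the same order.\<close>

lemma tally_core_M:
  "tally (map (cycle_type 8 (edge_list 8 (core_adj True))) (embeddings 8 (core_adj True) 8)) =
  [([(Var_a 1, 8), (Var_b 1, 19)], 1),
   ([(Var_a 1, 5), (Var_b 1, 10), (Var_a 3, 1), (Var_b 3, 3)], 4),
   ([(Var_a 1, 2), (Var_b 1, 1), (Var_a 3, 2), (Var_b 3, 6)], 4),
   ([(Var_a 1, 6), (Var_b 1, 12), (Var_c 1, 1), (Var_a 2, 1), (Var_b 2, 3)], 6),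
   ([(Var_a 1, 3), (Var_b 1, 3), (Var_c 1, 1), (Var_a 2, 1), (Var_b 2, 3), (Var_a 3, 1), (Var_b 3, 3)], 12),
   ([(Var_a 1, 4), (Var_b 1, 5), (Var_c 1, 2), (Var_a 2, 2), (Var_b 2, 6)], 9),
   ([(Var_a 1, 2), (Var_b 1, 1), (Var_a 6, 1), (Var_b 6, 3)], 12),
   ([(Var_a 1, 2), (Var_b 1, 1), (Var_a 2, 1), (Var_b 2, 2), (Var_c 2, 1), (Var_a 4, 1), (Var_b 4, 3)], 18),
   ([(Var_a 1, 2), (Var_b 1, 1), (Var_a 2, 3), (Var_b 2, 9)], 6),
   ([(Var_a 1, 6), (Var_b 1, 6), (Var_c 1, 1), (Var_a 2, 1), (Var_b 2, 6)], 1),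
   ([(Var_a 1, 3), (Var_b 1, 3), (Var_c 1, 1), (Var_a 2, 1), (Var_b 2, 3), (Var_a 3, 1), (Var_b 3, 1), (Var_b 6, 1)], 4),
   ([(Var_c 1, 1), (Var_a 2, 1), (Var_a 3, 2), (Var_b 3, 2), (Var_b 6, 2)], 4),
   ([(Var_a 1, 4), (Var_b 1, 3), (Var_c 1, 2), (Var_a 2, 2), (Var_b 2, 7)], 6),
   ([(Var_a 1, 1), (Var_c 1, 2), (Var_a 2, 2), (Var_b 2, 4), (Var_a 3, 1), (Var_b 3, 1), (Var_b 6, 1)], 12),
   ([(Var_a 1, 2), (Var_c 1, 3), (Var_a 2, 3), (Var_b 2, 8)], 9),
   ([(Var_c 1, 1), (Var_a 2, 1), (Var_a 6, 1), (Var_b 6, 3)], 12),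
   ([(Var_c 1, 1), (Var_a 2, 2), (Var_b 2, 2), (Var_c 2, 1), (Var_a 4, 1), (Var_b 4, 3)], 18),
   ([(Var_c 1, 1), (Var_a 2, 4), (Var_b 2, 9)], 6)]"
  by code_simp

text \<open>The group is unchanged. Each row loses the factor of the deleted edge: one
  \<open>Var_b 1\<close> where its ends are fixed, one \<open>Var_c 1\<close> where they are
  exchanged.\<close>

lemma tally_core_M_star:
  "tally (map (cycle_type 8 (edge_list 8 (core_adj False))) (embeddings 8 (core_adj False) 8)) =
  [([(Var_a 1, 8), (Var_b 1, 18)], 1),
   ([(Var_a 1, 5), (Var_b 1, 9), (Var_a 3, 1), (Var_b 3, 3)], 4),
   ([(Var_a 1, 2), (Var_a 3, 2), (Var_b 3, 6)], 4),
   ([(Var_a 1, 6), (Var_b 1, 11), (Var_c 1, 1), (Var_a 2, 1), (Var_b 2, 3)], 6),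
   ([(Var_a 1, 3), (Var_b 1, 2), (Var_c 1, 1), (Var_a 2, 1), (Var_b 2, 3), (Var_a 3, 1), (Var_b 3, 3)], 12),
   ([(Var_a 1, 4), (Var_b 1, 4), (Var_c 1, 2), (Var_a 2, 2), (Var_b 2, 6)], 9),
   ([(Var_a 1, 2), (Var_a 6, 1), (Var_b 6, 3)], 12),
   ([(Var_a 1, 2), (Var_a 2, 1), (Var_b 2, 2), (Var_c 2, 1), (Var_a 4, 1), (Var_b 4, 3)], 18),
   ([(Var_a 1, 2), (Var_a 2, 3), (Var_b 2, 9)], 6),
   ([(Var_a 1, 6), (Var_b 1, 6), (Var_a 2, 1), (Var_b 2, 6)], 1),
   ([(Var_a 1, 3), (Var_b 1, 3), (Var_a 2, 1), (Var_b 2, 3), (Var_a 3, 1), (Var_b 3, 1), (Var_b 6, 1)], 4),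
   ([(Var_a 2, 1), (Var_a 3, 2), (Var_b 3, 2), (Var_b 6, 2)], 4),
   ([(Var_a 1, 4), (Var_b 1, 3), (Var_c 1, 1), (Var_a 2, 2), (Var_b 2, 7)], 6),
   ([(Var_a 1, 1), (Var_c 1, 1), (Var_a 2, 2), (Var_b 2, 4), (Var_a 3, 1), (Var_b 3, 1), (Var_b 6, 1)], 12),
   ([(Var_a 1, 2), (Var_c 1, 2), (Var_a 2, 3), (Var_b 2, 8)], 9),
   ([(Var_a 2, 1), (Var_a 6, 1), (Var_b 6, 3)], 12),
   ([(Var_a 2, 2), (Var_b 2, 2), (Var_c 2, 1), (Var_a 4, 1), (Var_b 4, 3)], 18),
   ([(Var_a 2, 4), (Var_b 2, 9)], 6)]"
  by code_simp

theorem proposition5: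
  fixes P Q :: "'v set" and p q :: "'v \<times> 'v"
  assumes "disjoint_K5s P p Q q"
  shows "walsh_index (core_M P p Q q) = const (1 / 144) *
     (\<a> 1^8 * \<b> 1^19 + \<a> 1^6 * \<a> 2 * \<b> 1^6 * \<b> 2^6 * \<c> 1
      + 6 * (\<a> 1^6 * \<a> 2 * \<b> 1^12 * \<b> 2^3 * \<c> 1 + \<a> 1^4 * \<a> 2^2 * \<b> 1^3 * \<b> 2^7 * \<c> 1^2)
      + 9 * (\<a> 1^4 * \<a> 2^2 * \<b> 1^5 * \<b> 2^6 * \<c> 1^2 + \<a> 1^2 * \<a> 2^3 * \<b> 2^8 * \<c> 1^3)
      + 6 * (\<a> 1^2 * \<a> 2^3 * \<b> 1 * \<b> 2^9 + \<a> 2^4 * \<b> 2^9 * \<c> 1)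
      + 4 * (\<a> 1^5 * \<a> 3 * \<b> 1^10 * \<b> 3^3 + \<a> 1^3 * \<a> 2 * \<a> 3 * \<b> 1^3 * \<b> 2^3 * \<b> 3 * \<b> 6 * \<c> 1)
      + 12 * (\<a> 1^3 * \<a> 2 * \<a> 3 * \<b> 1^3 * \<b> 2^3 * \<b> 3^3 * \<c> 1 + \<a> 1 * \<a> 2^2 * \<a> 3 * \<b> 2^4 * \<b> 3 * \<b> 6 * \<c> 1^2)
      + 4 * (\<a> 1^2 * \<a> 3^2 * \<b> 1 * \<b> 3^6 + \<a> 2 * \<a> 3^2 * \<b> 3^2 * \<b> 6^2 * \<c> 1)
      + 18 * (\<a> 1^2 * \<a> 2 * \<a> 4 * \<b> 1 * \<b> 2^2 * \<b> 4^3 * \<c> 2 + \<a> 2^2 * \<a> 4 * \<b> 2^2 * \<b> 4^3 * \<c> 1 * \<c> 2)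
      + 12 * (\<a> 1^2 * \<a> 6 * \<b> 1 * \<b> 6^3 + \<a> 2 * \<a> 6 * \<b> 6^3 * \<c> 1)) \<and>
    walsh_index (core_M_star P p Q q) = const (1 / 144) *
     (\<a> 1^8 * \<b> 1^18 + \<a> 1^6 * \<a> 2 * \<b> 1^6 * \<b> 2^6
      + 6 * (\<a> 1^6 * \<a> 2 * \<b> 1^11 * \<b> 2^3 * \<c> 1 + \<a> 1^4 * \<a> 2^2 * \<b> 1^3 * \<b> 2^7 * \<c> 1)
      + 9 * (\<a> 1^4 * \<a> 2^2 * \<b> 1^4 * \<b> 2^6 * \<c> 1^2 + \<a> 1^2 * \<a> 2^3 * \<b> 2^8 * \<c> 1^2)
      + 6 * (\<a> 1^2 * \<a> 2^3 * \<b> 2^9 + \<a> 2^4 * \<b> 2^9)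
      + 4 * (\<a> 1^5 * \<a> 3 * \<b> 1^9 * \<b> 3^3 + \<a> 1^3 * \<a> 2 * \<a> 3 * \<b> 1^3 * \<b> 2^3 * \<b> 3 * \<b> 6)
      + 12 * (\<a> 1^3 * \<a> 2 * \<a> 3 * \<b> 1^2 * \<b> 2^3 * \<b> 3^3 * \<c> 1 + \<a> 1 * \<a> 2^2 * \<a> 3 * \<b> 2^4 * \<b> 3 * \<b> 6 * \<c> 1)
      + 4 * (\<a> 1^2 * \<a> 3^2 * \<b> 3^6 + \<a> 2 * \<a> 3^2 * \<b> 3^2 * \<b> 6^2)
      + 18 * (\<a> 1^2 * \<a> 2 * \<a> 4 * \<b> 2^2 * \<b> 4^3 * \<c> 2 + \<a> 2^2 * \<a> 4 * \<b> 2^2 * \<b> 4^3 * \<c> 2)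
      + 12 * (\<a> 1^2 * \<a> 6 * \<b> 6^3 + \<a> 2 * \<a> 6 * \<b> 6^3))"
proof -
  obtain lab where lab: "labelled_graph lab 8 (core_adj True)"
    and lab': "labelled_graph lab 8 (core_adj False)"
    and M: "core_M P p Q q = labelled_graph.G lab 8 (core_adj True)"
    and M': "core_M_star P p Q q = labelled_graph.G lab 8 (core_adj False)"
    by (rule core_labelling[OF assms])
  \<comment> \<open>The multiplicities of either table add up to 144; expansion matches its 18 rows
    with the bracketed pairs.\<close>
  show ?thesis
    unfolding M M' labelled_graph.walsh_index_G[OF lab tally_core_M]
      labelled_graph.walsh_index_G[OF lab' tally_core_M_star]
    by (simp add: monomial_def \<a>_def \<b>_def \<c>_def algebra_simps)
qed

end
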